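(* Let $m\ge 2$, let $\pi$ be a permutation of $\{1,\dots,m-1\}$ with disjoint cycle decomposition $\pi=\tau_1\tau_2\cdots\tau_q$, and let $s=\operatorname{lcm}(\operatorname{ord}(\tau_1),\dots,\operatorname{ord}(\tau_q))$. Let $V_\pi\colon S^{m-1}\to S^{m-1}$, $V_\pi(\mathbf{x})=\mathbf{x}'$, be given by $$x'_k=2x_m x_{\pi(k)}\ \ (1\le k\le m-1),\qquad x'_m=x_m^2+(x_1+\dots+x_{m-1})^2 .$$ Then: (i) $V_\pi(\mathbf{x})=\mathbf{e}_m$ for any $\mathbf{x}\in\{\mathbf{x}\in S^{m-1}: x_m=0\}\cup\{\mathbf{e}_m\}$; (ii) for any $\mathbf{x}^{(0)}\in S^{m-1}\setminus\big(\{\mathbf{x}\in S^{m-1}: x_m=0\}\cup\{\mathbf{e}_m\}\big)$, with trajectory $\mathbf{x}^{(n)}=V_\pi^n(\mathbf{x}^{(0)})$, the limits $\xi_k=\lim_{n\to\infty}x_k^{(ns)}$, $1\le k\le m-1$, exist and $$\omega_{V_\pi}(\mathbf{x}^{(0)})=\{\mathbf{x}_\xi,\mathbf{x}_\xi^{1},\dots,\mathbf{x}_\xi^{s-1}\},$$ where $\mathbf{x}_\xi=(\xi_1,\dots,\xi_{m-1},1/2)$ and $\mathbf{x}_\xi^{j}=(\xi_{\pi^j(1)},\dots,\xi_{\pi^j(m-1)},1/2)$ for $j=1,\dots,s-1$.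
   Context: $S^{m-1}=\{\mathbf{x}=(x_1,\dots,x_m)\in\mathbb{R}^m: x_i\ge 0 \text{ for all } i,\ \sum_{i=1}^m x_i=1\}$; $\mathbf{e}_m=(0,\dots,0,1)$. The cycle decomposition of $\pi$ includes every element of $\{1,\dots,m-1\}$, fixed points of $\pi$ being cycles of order 1; $\operatorname{ord}(\tau_i)$ is the order (length) of the cycle $\tau_i$. $\omega_{V}(\mathbf{x}^{(0)})$ denotes the set of limit points of the trajectory $\{V^n(\mathbf{x}^{(0)})\}_{n\ge 0}$, i.e. the set of limits of its convergent subsequences. *)

theory Defs
  imports "HOL-Analysis.Analysis" "HOL-Combinatorics.Combinatorics"
begin

text \<open>A point of \<open>\<real>\<^sup>m\<close> is a function \<open>nat \<Rightarrow> real\<close> that vanishes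
  outside \<open>{1..m}\<close>. On such functions the library's product topology on \<open>nat \<Rightarrow> real\<close> is the
  Euclidean topology of \<open>\<real>\<^sup>m\<close>, so sequence limits have their usual meaning.\<close>

definition std_simplex :: "nat \<Rightarrow> (nat \<Rightarrow> real) set" where
  "std_simplex m =
     {x. (\<forall>i\<in>{1..m}. 0 \<le> x i) \<and> (\<Sum>i=1..m. x i) = 1 \<and> (\<forall>i. i \<notin> {1..m} \<longrightarrow> x i = 0)}"

definition vertex :: "nat \<Rightarrow> nat \<Rightarrow> real" where
  "vertex m = (\<lambda>i. if i = m then 1 else 0)"

text \<open>\<open>cs\<close> lists the disjoint cycles of \<open>p\<close> on \<open>A\<close>. A cycle \<open>a \<mapsto> b \<mapsto> c \<mapsto> a\<close> is represented by
  \<open>[a, b, c]\<close>, and a fixed point \<open>a\<close> by \<open>[a]\<close>, so the order of a cycle is the length of its list.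
  The conjuncts about \<open>concat\<close> say that each list is repetition-free, that different
  cycles are disjoint, and that every element of \<open>A\<close> occurs.\<close>

definition disjoint_cycles :: "'a set \<Rightarrow> ('a \<Rightarrow> 'a) \<Rightarrow> 'a list list \<Rightarrow> bool" where
  "disjoint_cycles A p cs \<longleftrightarrow>
     p = foldr (\<circ>) (map cycle_of_list cs) id \<and>
     [] \<notin> set cs \<and> distinct (concat cs) \<and> set (concat cs) = A"

lemma disjoint_cycles_exists:
  assumes "p permutes A" and "finite A"
  shows "\<exists>cs. disjoint_cycles A p cs"
proof -
  have "cycle_decomp A p"
    using cycle_decomposition assms by blast
  then show ?thesis
  proof (induction rule: cycle_decomp.induct)
    case empty
    show ?case
      by (rule exI[of _ "[]"]) (simp add: disjoint_cycles_def id_def)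
  next
    case (comp I p c)
    then obtain cs where cs: "disjoint_cycles I p cs" by blast
    show ?case
    proof (cases "c = []")
      case True
      then show ?thesis using cs by (auto simp: id_def fun_eq_iff comp_def)
    next
      case False
      then have "disjoint_cycles (set c \<union> I) (cycle_of_list c \<circ> p) (c # cs)"
        using cs comp.hyps by (auto simp: disjoint_cycles_def)
      then show ?thesis by blast
    qed
  qed
qed

definition V :: "nat \<Rightarrow> (nat \<Rightarrow> nat) \<Rightarrow> (nat \<Rightarrow> real) \<Rightarrow> (nat \<Rightarrow> real)" where
  "V m p x = (\<lambda>k. if k \<in> {1..m-1} then 2 * x m * x (p k)
                  else if k = m then (x m)\<^sup>2 + (\<Sum>i=1..m-1. x i)\<^sup>2
                  else 0)"

lemma V_in_std_simplex:
  assumes m: "m \<ge> 2" and p: "p permutes {1..m-1}" and x: "x \<in> std_simplex m"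
  shows "V m p x \<in> std_simplex m"
proof -
  have split: "(\<Sum>i=1..m. f i) = (\<Sum>i=1..m-1. f i) + f m" for f :: "nat \<Rightarrow> real"
    using m by (cases m) auto
  have nn: "0 \<le> x i" for i
    using x by (cases "i \<in> {1..m}") (auto simp: std_simplex_def)
  have one: "(\<Sum>i=1..m-1. x i) + x m = 1"
    using x split[of x] by (simp add: std_simplex_def)
  have "(\<Sum>k=1..m-1. V m p x k) = (\<Sum>k=1..m-1. 2 * x m * x (p k))"
    by (rule sum.cong) (auto simp: V_def)
  also have "\<dots> = 2 * x m * (\<Sum>k=1..m-1. x (p k))"
    by (simp add: sum_distrib_left)
  also have "(\<Sum>k=1..m-1. x (p k)) = (\<Sum>k=1..m-1. x k)"
    using sum.permute[OF p, of x] by (simp add: o_def)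
  finally have "(\<Sum>k=1..m. V m p x k) =
      2 * x m * (\<Sum>k=1..m-1. x k) + ((x m)\<^sup>2 + (\<Sum>i=1..m-1. x i)\<^sup>2)"
    using m by (subst split) (auto simp: V_def)
  also have "\<dots> = ((\<Sum>i=1..m-1. x i) + x m)\<^sup>2"
    by (simp add: power2_eq_square algebra_simps)
  finally have "(\<Sum>k=1..m. V m p x k) = 1"
    using one by simp
  then show ?thesis
    using m nn by (auto simp: std_simplex_def V_def)
qed

definition limit_points :: "('a \<Rightarrow> 'a) \<Rightarrow> 'a \<Rightarrow> 'a::topological_space set" where
  "limit_points f x = {y. \<exists>r. strict_mono r \<and> (\<lambda>n. (f ^^ r n) x) \<longlonglongrightarrow> y}"

text \<open>The point \<open>(\<xi>\<^sub>1, \<dots>, \<xi>\<^bsub>m-1\<^esub>, 1/2)\<close>.\<close>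

definition half_point :: "nat \<Rightarrow> (nat \<Rightarrow> real) \<Rightarrow> (nat \<Rightarrow> real)" where
  "half_point m \<xi> = (\<lambda>k. if k \<in> {1..m-1} then \<xi> k else if k = m then 1/2 else 0)"

end

theory Submission
  imports Defs
begin

text \<open>
  The map acts on the last coordinate alone by \<open>y \<mapsto> y\<^sup>2 + (1 - y)\<^sup>2\<close>, which in the
  coordinate \<open>u = 2 y - 1\<close> is squaring. Hence \<open>u\<close> equals \<open>u\<^sub>0\<^bsup>2^n\<^esup>\<close> after \<open>n\<close> steps, and this
  tends to \<open>0\<close> when \<open>0 < y\<^sub>0 < 1\<close>; if \<open>y\<^sub>0\<close> is \<open>0\<close> or \<open>1\<close>, then \<open>y = 1\<close> after one step, and
  only the vertex has this last coordinate. One step multiplies each of the other coordinates by the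
  same factor \<open>2 y\<close> and permutes them by \<open>\<pi>\<close>. The common factor accumulated after \<open>n\<close> steps
  needs no estimate of the product: it multiplies the total mass \<open>1 - y\<close> of these coordinates
  as well, so it is the quotient of the final and the initial mass. The iterates are therefore
  known explicitly (\<open>V_funpow\<close>): up to a scalar factor that tends to
  \<open>1 / (2 (1 - y\<^sub>0))\<close>, the vector of the first \<open>m - 1\<close> coordinates is \<open>x\<^sub>0 \<circ> \<pi>\<^sup>n\<close>.

  The order of \<open>\<pi>\<close> divides \<open>s\<close>, the least common multiple of its cycle lengths
  (\<open>disjoint_cycles_funpow_id\<close>). So along each residue class \<open>n \<equiv> j\<close> modulo \<open>s\<close> the
  permutation \<open>\<pi>\<^sup>n = \<pi>\<^sup>j\<close> is constant and the trajectory converges. By the pigeonhole principle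
  the limits of these \<open>s\<close> subsequences are all the limit points
  (\<open>limit_points_residue_classes\<close>).
\<close>

section \<open>The order of a permutation with given cycles\<close>

lemma funpow_comp_commute:
  assumes "f \<circ> g = g \<circ> f"
  shows "(f \<circ> g) ^^ n = f ^^ n \<circ> g ^^ n"
proof (induction n)
  case (Suc n)
  have comm: "g \<circ> f ^^ n = f ^^ n \<circ> g"
  proof (induction n)
    case (Suc n)
    then show ?case
      using assms by (metis funpow.simps(2) o_assoc)
  qed simp
  have "(f \<circ> g) ^^ Suc n = f \<circ> (g \<circ> f ^^ n) \<circ> g ^^ n"
    by (simp only: Suc funpow.simps o_assoc)
  then show ?case
    by (simp only: comm funpow.simps o_assoc)
qed simp

lemma cycle_commutes_with_disjoint_product:
  assumes "distinct c" "distinct (concat cs)" "set c \<inter> set (concat cs) = {}"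
  shows "cycle_of_list c \<circ> foldr (\<circ>) (map cycle_of_list cs) id =
         foldr (\<circ>) (map cycle_of_list cs) id \<circ> cycle_of_list c"
  using assms
proof (induction cs)
  case (Cons d cs)
  let ?p = "foldr (\<circ>) (map cycle_of_list cs) id"
  have cd: "cycle_of_list c \<circ> cycle_of_list d = cycle_of_list d \<circ> cycle_of_list c"
    using Cons.prems by (intro cycles_commute) auto
  have cp: "cycle_of_list c \<circ> ?p = ?p \<circ> cycle_of_list c"
    using Cons.prems by (intro Cons.IH) auto
  have "foldr (\<circ>) (map cycle_of_list (d # cs)) id = cycle_of_list d \<circ> ?p" by simp
  with cd cp show ?case by (metis o_assoc)
qed simp

text \<open>Disjoint cycles commute, so a power of their product is the product of their powers.\<close>

lemma disjoint_cycles_funpow_id: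
  assumes "disjoint_cycles A p cs" and "\<And>c. c \<in> set cs \<Longrightarrow> length c dvd n"
  shows "p ^^ n = id"
proof -
  have "foldr (\<circ>) (map cycle_of_list cs) id ^^ n = id"
    if "distinct (concat cs)" "\<forall>c\<in>set cs. length c dvd n"
    using that
  proof (induction cs)
    case (Cons c cs)
    have c: "distinct c" "set c \<inter> set (concat cs) = {}" "distinct (concat cs)"
      using Cons.prems by auto
    obtain k where n: "n = length c * k"
      using Cons.prems by (auto elim: dvdE)
    have "cycle_of_list c ^^ n = id"
      unfolding n funpow_mult[symmetric] cycle_is_id_root[OF c(1)] by (rule id_funpow)
    moreover have "foldr (\<circ>) (map cycle_of_list cs) id ^^ n = id"
      using c(3) Cons.prems(2) by (intro Cons.IH) simp_all
    moreover have "foldr (\<circ>) (map cycle_of_list (c # cs)) id =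
        cycle_of_list c \<circ> foldr (\<circ>) (map cycle_of_list cs) id"
      by simp
    ultimately show ?case
      using funpow_comp_commute[OF cycle_commutes_with_disjoint_product[OF c(1,3,2)], of n]
      by (metis comp_id)
  qed simp
  with assms show ?thesis by (auto simp: disjoint_cycles_def)
qed

lemma Lcm_cycle_lengths_pos:
  assumes "disjoint_cycles A p cs"
  shows "0 < Lcm (length ` set cs)"
proof -
  have "0 \<notin> length ` set cs"
    using assms by (auto simp: disjoint_cycles_def)
  then have "Lcm (length ` set cs) \<noteq> 0"
    by (subst Lcm_0_iff) auto
  then show ?thesis unfolding neq0_conv .
qed

section \<open>Limit points of asymptotically periodic trajectories\<close>

text \<open>Any subsequence visits some residue class modulo \<open>s\<close> infinitely often, so its limit
  is the limit along that class.\<close>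

lemma limit_points_residue_classes:
  fixes x :: "'a::t2_space"
  assumes s: "0 < s"
    and lim: "\<And>j. j < s \<Longrightarrow> (\<lambda>n. (f ^^ (n * s + j)) x) \<longlonglongrightarrow> z j"
  shows "limit_points f x = z ` {..<s}"
proof (intro equalityI subsetI)
  fix y assume "y \<in> z ` {..<s}"
  then obtain j where j: "j < s" "y = z j" by auto
  have "strict_mono (\<lambda>n. n * s + j)"
    using s by (auto simp: strict_mono_def)
  with lim[OF j(1)] j(2) show "y \<in> limit_points f x"
    by (auto simp: limit_points_def)
next
  fix y assume "y \<in> limit_points f x"
  then obtain r where r: "strict_mono r" "(\<lambda>n. (f ^^ r n) x) \<longlonglongrightarrow> y"
    by (auto simp: limit_points_def)
  have "range (\<lambda>n. r n mod s) \<subseteq> {..<s}"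
    using s by auto
  then have "finite (range (\<lambda>n. r n mod s))"
    by (rule finite_subset) simp
  then obtain n0 where "infinite {n \<in> UNIV. r n mod s = r n0 mod s}"
    using pigeonhole_infinite[OF infinite_UNIV_nat] by blast
  then obtain e :: "nat \<Rightarrow> nat"
    where e: "strict_mono e" "\<And>n. r (e n) mod s = r n0 mod s"
    by (auto dest: infinite_enumerate)
  define j where "j = r n0 mod s"
  have js: "j < s" using s by (simp add: j_def)
  have "strict_mono (r \<circ> e)"
    using r(1) e(1) by (rule strict_mono_o)
  then have "filterlim (r \<circ> e) at_top sequentially"
    by (rule filterlim_subseq)
  then have "filterlim (\<lambda>n. r (e n) div s) at_top sequentially"
    using filterlim_at_top_div_const_nat[OF s] by (auto simp: o_def intro: filterlim_compose)
  then have "(\<lambda>n. (f ^^ ((r (e n) div s) * s + j)) x) \<longlonglongrightarrow> z j"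
    using lim[OF js] by (rule filterlim_compose[rotated])
  moreover have "r (e n) div s * s + j = r (e n)" for n
    using div_mult_mod_eq[of "r (e n)" s] by (simp add: j_def e(2))
  ultimately have "(\<lambda>n. (f ^^ r (e n)) x) \<longlonglongrightarrow> z j"
    by simp
  moreover have "(\<lambda>n. (f ^^ r (e n)) x) \<longlonglongrightarrow> y"
    using LIMSEQ_subseq_LIMSEQ[OF r(2) e(1)] by (simp add: o_def)
  ultimately have "y = z j" by (rule LIMSEQ_unique[symmetric])
  with js show "y \<in> z ` {..<s}" by auto
qed

lemma tendsto_fun_coordinatewise:
  fixes f :: "'a \<Rightarrow> 'i \<Rightarrow> 'b::topological_space"
  shows "(f \<longlongrightarrow> l) F \<longleftrightarrow> (\<forall>i. ((\<lambda>x. f x i) \<longlongrightarrow> l i) F)"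
  using limitin_componentwise[of "\<lambda>_. euclidean" UNIV f l F]
  by (simp add: euclidean_product_topology)

section \<open>The iterates in closed form\<close>

lemma std_simplex_sum_init:
  assumes "m \<ge> 2" and "x \<in> std_simplex m"
  shows "(\<Sum>i=1..m-1. x i) = 1 - x m"
proof -
  have "(\<Sum>i=1..m. x i) = (\<Sum>i=1..m-1. x i) + x m"
    using assms(1) by (cases m) auto
  then show ?thesis
    using assms(2) by (simp add: std_simplex_def)
qed

lemma vertex_in_std_simplex: "m \<ge> 2 \<Longrightarrow> vertex m \<in> std_simplex m"
  by (auto simp: std_simplex_def vertex_def)

lemma std_simplex_last_bounds:
  assumes m: "m \<ge> 2" and x: "x \<in> std_simplex m"
  shows "0 \<le> x m" and "x m \<le> 1" and "x m = 1 \<longleftrightarrow> x = vertex m"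
proof -
  have nn: "\<forall>i\<in>{1..m}. 0 \<le> x i" and out: "\<And>i. i \<notin> {1..m} \<Longrightarrow> x i = 0"
    using x by (auto simp: std_simplex_def)
  show "0 \<le> x m" using nn m by auto
  have "0 \<le> (\<Sum>i=1..m-1. x i)"
    using nn by (intro sum_nonneg) auto
  then show "x m \<le> 1"
    using std_simplex_sum_init[OF m x] by simp
  have "x = vertex m" if "x m = 1"
  proof
    have "(\<Sum>i=1..m-1. x i) = 0"
      using std_simplex_sum_init[OF m x] that by simp
    then have "\<forall>i\<in>{1..m-1}. x i = 0"
      using nn by (subst (asm) sum_nonneg_eq_0_iff) auto
    then show "x i = vertex m i" for i
      using out[of i] that by (cases "i \<in> {1..m-1}") (auto simp: vertex_def)
  qed
  then show "x m = 1 \<longleftrightarrow> x = vertex m" by (auto simp: vertex_def)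
qed

lemma V_eq_vertex:
  assumes m: "m \<ge> 2" and p: "p permutes {1..m-1}" and x: "x \<in> std_simplex m"
    and last: "x m = 0 \<or> x m = 1"
  shows "V m p x = vertex m"
proof -
  have "V m p x m = 1"
    using last m std_simplex_sum_init[OF m x] by (auto simp: V_def)
  with std_simplex_last_bounds(3)[OF m V_in_std_simplex[OF m p x]] show ?thesis
    by simp
qed

lemma V_funpow_in_std_simplex:
  assumes "m \<ge> 2" "p permutes {1..m-1}" "x \<in> std_simplex m"
  shows "(V m p ^^ n) x \<in> std_simplex m"
  by (induction n) (auto intro: V_in_std_simplex assms)

text \<open>In the coordinate \<open>u = 2 y - 1\<close> the map \<open>y \<mapsto> y\<^sup>2 + (1 - y)\<^sup>2\<close> is \<open>u \<mapsto> u\<^sup>2\<close>.\<close>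

lemma V_funpow_last:
  assumes "m \<ge> 2" "p permutes {1..m-1}" "x \<in> std_simplex m"
  shows "(V m p ^^ n) x m = (1 + (2 * x m - 1) ^ (2 ^ n)) / 2"
proof (induction n)
  case (Suc n)
  define y where "y = (V m p ^^ n) x"
  have y: "y \<in> std_simplex m"
    unfolding y_def by (rule V_funpow_in_std_simplex[OF assms])
  have u: "2 * y m - 1 = (2 * x m - 1) ^ (2 ^ n)"
    unfolding y_def Suc by (simp add: add_divide_distrib)
  have "(V m p ^^ Suc n) x m = (y m)\<^sup>2 + (1 - y m)\<^sup>2"
    using assms(1) std_simplex_sum_init[OF assms(1) y] by (auto simp: V_def y_def)
  also have "\<dots> = (1 + (2 * y m - 1)\<^sup>2) / 2"
    by (simp add: power2_eq_square algebra_simps)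
  also have "\<dots> = (1 + (2 * x m - 1) ^ (2 ^ Suc n)) / 2"
    unfolding u by (simp add: power_mult[symmetric] mult.commute)
  finally show ?case .
qed simp

text \<open>The scalar is the total mass of the first \<open>m - 1\<close> coordinates after \<open>n\<close> steps, divided by
  their initial mass \<open>1 - x m\<close>: a step multiplies this mass by the same factor as each of these
  coordinates.\<close>

lemma V_funpow:
  assumes m: "m \<ge> 2" and p: "p permutes {1..m-1}" and x: "x \<in> std_simplex m"
    and "x m \<noteq> 1" and "k \<in> {1..m-1}"
  shows "(V m p ^^ n) x k =
    (1 - (2 * x m - 1) ^ (2 ^ n)) / (2 * (1 - x m)) * x ((p ^^ n) k)"
  using \<open>k \<in> {1..m-1}\<close>
proof (induction n arbitrary: k)
  case 0
  then show ?case using \<open>x m \<noteq> 1\<close> by (simp add: field_simps)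
next
  case (Suc n)
  define u where "u = (2 * x m - 1) ^ (2 ^ n)"
  have pk: "p k \<in> {1..m-1}"
    using permutes_in_image[OF p] Suc.prems by blast
  have "(V m p ^^ Suc n) x k = 2 * (V m p ^^ n) x m * (V m p ^^ n) x (p k)"
    using Suc.prems by (simp add: V_def)
  also have "\<dots> = (1 + u) * ((1 - u) / (2 * (1 - x m)) * x ((p ^^ Suc n) k))"
    unfolding V_funpow_last[OF m p x] Suc.IH[OF pk] u_def[symmetric]
    by (simp only: funpow_Suc_right o_apply)
  also have "\<dots> = (1 - u\<^sup>2) / (2 * (1 - x m)) * x ((p ^^ Suc n) k)"
    by (simp add: power2_eq_square algebra_simps flip: add_divide_distrib diff_divide_distrib)
  also have "u\<^sup>2 = (2 * x m - 1) ^ (2 ^ Suc n)"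
    by (simp add: u_def power_mult[symmetric] mult.commute)
  finally show ?case .
qed

section \<open>Convergence along residue classes\<close>

lemma V_funpow_residue_class_tendsto:
  assumes m: "m \<ge> 2" and p: "p permutes {1..m-1}" and x: "x \<in> std_simplex m"
    and "x m \<noteq> 0" "x m \<noteq> 1" and s: "0 < s" "p ^^ s = id"
  shows "(\<lambda>n. (V m p ^^ (n * s + j)) x) \<longlonglongrightarrow>
    half_point m (\<lambda>k. x ((p ^^ j) k) / (2 * (1 - x m)))"
proof -
  define u where "u = 2 * x m - 1"
  have "\<bar>u\<bar> < 1"
    using std_simplex_last_bounds[OF m x] \<open>x m \<noteq> 0\<close> \<open>x m \<noteq> 1\<close> by (auto simp: u_def)
  moreover have "strict_mono (\<lambda>n. (2::nat) ^ (n * s + j))"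
    using s(1) by (auto simp: strict_mono_def)
  ultimately have u: "(\<lambda>n. u ^ (2 ^ (n * s + j))) \<longlonglongrightarrow> 0"
    using LIMSEQ_subseq_LIMSEQ[OF LIMSEQ_power_zero, of u "\<lambda>n. 2 ^ (n * s + j)"]
    by (simp add: o_def)
  have period: "p ^^ (n * s + j) = p ^^ j" for n
  proof -
    have "p ^^ (n * s) = id"
      by (metis s(2) funpow_mult id_funpow mult.commute)
    then show ?thesis by (simp add: funpow_add)
  qed
  have "(\<lambda>n. (V m p ^^ (n * s + j)) x k) \<longlonglongrightarrow>
      half_point m (\<lambda>k. x ((p ^^ j) k) / (2 * (1 - x m))) k" for k
  proof -
    consider "k \<in> {1..m-1}" | "k = m" | "k \<notin> {1..m}" by fastforce
    then show ?thesis
    proof cases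
      case 1
      have "(\<lambda>n. (1 - u ^ (2 ^ (n * s + j))) / (2 * (1 - x m)) * x ((p ^^ j) k)) \<longlonglongrightarrow>
          (1 - 0) / (2 * (1 - x m)) * x ((p ^^ j) k)"
        using \<open>x m \<noteq> 1\<close> by (intro tendsto_intros u) auto
      then show ?thesis
        using 1 \<open>x m \<noteq> 1\<close> by (simp add: V_funpow[OF m p x] period u_def half_point_def)
    next
      case 2
      have "(\<lambda>n. (1 + u ^ (2 ^ (n * s + j))) / 2) \<longlonglongrightarrow> (1 + 0) / 2"
        by (intro tendsto_intros u) auto
      then show ?thesis
        using 2 m by (auto simp: V_funpow_last[OF m p x] u_def half_point_def)
    next
      case 3
      then have "(V m p ^^ (n * s + j)) x k = 0" for n
        using V_funpow_in_std_simplex[OF m p x] unfolding std_simplex_def by blast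
      then show ?thesis using 3 m by (auto simp: half_point_def)
    qed
  qed
  then show ?thesis by (simp add: tendsto_fun_coordinatewise)
qed

theorem theorem4p7:
  fixes m s :: nat and \<pi> :: "nat \<Rightarrow> nat" and \<tau> :: "nat list list"
  assumes "m \<ge> 2"
    and "\<pi> permutes {1..m-1}"
    and "disjoint_cycles {1..m-1} \<pi> \<tau>"
    and "s = Lcm (length ` set \<tau>)"
  shows "(\<forall>x \<in> {x \<in> std_simplex m. x m = 0} \<union> {vertex m}. V m \<pi> x = vertex m) \<and>
    (\<forall>x0 \<in> std_simplex m - ({x \<in> std_simplex m. x m = 0} \<union> {vertex m}).
       \<exists>\<xi> :: nat \<Rightarrow> real.
         (\<forall>k\<in>{1..m-1}. (\<lambda>n. (V m \<pi> ^^ (n * s)) x0 k) \<longlonglongrightarrow> \<xi> k) \<and>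
         limit_points (V m \<pi>) x0 =
           {half_point m \<xi>} \<union>
           {half_point m (\<lambda>k. \<xi> ((\<pi> ^^ j) k)) | j. j \<in> {1..s-1}})"
proof (intro conjI ballI)
  fix x assume "x \<in> {x \<in> std_simplex m. x m = 0} \<union> {vertex m}"
  then have "x \<in> std_simplex m" "x m = 0 \<or> x m = 1"
    using vertex_in_std_simplex[OF assms(1)] by (auto simp: vertex_def)
  then show "V m \<pi> x = vertex m"
    by (rule V_eq_vertex[OF assms(1,2)])
next
  fix x0 assume "x0 \<in> std_simplex m - ({x \<in> std_simplex m. x m = 0} \<union> {vertex m})"
  then have x0: "x0 \<in> std_simplex m" "x0 m \<noteq> 0" "x0 m \<noteq> 1"
    using std_simplex_last_bounds(3)[OF assms(1)] by auto
  have s: "0 < s" "\<pi> ^^ s = id"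
    using Lcm_cycle_lengths_pos[OF assms(3)] disjoint_cycles_funpow_id[OF assms(3), of s]
    by (simp_all add: assms(4))
  define \<xi> where "\<xi> = (\<lambda>k. x0 k / (2 * (1 - x0 m)))"
  define z where "z = (\<lambda>j. half_point m (\<lambda>k. \<xi> ((\<pi> ^^ j) k)))"
  have lim: "(\<lambda>n. (V m \<pi> ^^ (n * s + j)) x0) \<longlonglongrightarrow> z j" for j
    using V_funpow_residue_class_tendsto[OF assms(1,2) x0 s] by (simp add: z_def \<xi>_def)
  have "(\<lambda>n. (V m \<pi> ^^ (n * s)) x0 k) \<longlonglongrightarrow> z 0 k" for k
    using lim[of 0] by (simp add: tendsto_fun_coordinatewise)
  then have "(\<lambda>n. (V m \<pi> ^^ (n * s)) x0 k) \<longlonglongrightarrow> \<xi> k" if "k \<in> {1..m-1}" for k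
    using that by (metis z_def half_point_def funpow_0)
  moreover have "limit_points (V m \<pi>) x0 = z ` {..<s}"
    by (rule limit_points_residue_classes[OF s(1) lim])
  moreover have "{..<s} = insert 0 {1..s-1}"
    using s(1) by auto
  then have "z ` {..<s} = insert (z 0) (z ` {1..s-1})"
    by (simp only: image_insert)
  moreover have "z ` {1..s-1} = {half_point m (\<lambda>k. \<xi> ((\<pi> ^^ j) k)) | j. j \<in> {1..s-1}}"
    unfolding z_def by (rule Setcompr_eq_image[symmetric])
  moreover have "z 0 = half_point m \<xi>"
    by (simp add: z_def)
  ultimately show "\<exists>\<xi>. (\<forall>k\<in>{1..m-1}. (\<lambda>n. (V m \<pi> ^^ (n * s)) x0 k) \<longlonglongrightarrow> \<xi> k) \<and>
      limit_points (V m \<pi>) x0 = {half_point m \<xi>} \<union>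
        {half_point m (\<lambda>k. \<xi> ((\<pi> ^^ j) k)) | j. j \<in> {1..s-1}}"
    by (intro exI[of _ \<xi>]) simp
qed

end
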